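(* For every integer $k\ge 5$, $P_k\not\le C_{k-2}$.
   Context: All graphs are finite and simple, considered up to isomorphism. An edge-colored graph is a pair $(G,c)$ with $c\colon E(G)\to\mathbb{N}$ an arbitrary map (not necessarily proper); it is colored in $t$ or more colors if $|c(E(G))|\ge t$. A subgraph (not necessarily induced) is rainbow if its edges receive pairwise distinct colors. $(G,c)$ is rainbow $H$-free if $G$ contains no rainbow subgraph isomorphic to $H$. For graphs $H_1,H_2$, write $H_1\le H_2$ if there is a positive integer $t$ such that every rainbow $H_1$-free edge-colored complete graph colored in $t$ or more colors is rainbow $H_2$-free. $P_k$ and $C_k$ are the path and the cycle on $k$ vertices. *)

theory Defs
  imports Main
begin

type_synonym 'a graph = "'a set \<times> 'a set set"

abbreviation verts :: "'a graph \<Rightarrow> 'a set" where "verts \<equiv> fst"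
abbreviation edges :: "'a graph \<Rightarrow> 'a set set" where "edges \<equiv> snd"

definition simple_graph :: "'a graph \<Rightarrow> bool" where
  "simple_graph G \<longleftrightarrow>
     finite (verts G) \<and> edges G \<subseteq> {e. e \<subseteq> verts G \<and> card e = 2}"

definition complete_graph :: "'a graph \<Rightarrow> bool" where
  "complete_graph G \<longleftrightarrow>
     simple_graph G \<and> edges G = {e. e \<subseteq> verts G \<and> card e = 2}"

definition graph_iso :: "'a graph \<Rightarrow> 'b graph \<Rightarrow> bool" where
  "graph_iso G H \<longleftrightarrow>
     (\<exists>f. bij_betw f (verts G) (verts H) \<and>
          (\<forall>u \<in> verts G. \<forall>v \<in> verts G. {u, v} \<in> edges G \<longleftrightarrow> {f u, f v} \<in> edges H))"

definition subgraph :: "'a graph \<Rightarrow> 'a graph \<Rightarrow> bool" where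
  "subgraph F G \<longleftrightarrow>
     simple_graph F \<and> verts F \<subseteq> verts G \<and> edges F \<subseteq> edges G"

text \<open>An edge coloring is a total function on vertex sets; only its values on the edges of
  the graph under consideration are ever used.\<close>

definition colored_in_at_least :: "'a graph \<Rightarrow> ('a set \<Rightarrow> nat) \<Rightarrow> nat \<Rightarrow> bool" where
  "colored_in_at_least G c t \<longleftrightarrow> card (c ` edges G) \<ge> t"

definition rainbow :: "'a graph \<Rightarrow> ('a set \<Rightarrow> nat) \<Rightarrow> bool" where
  "rainbow F c \<longleftrightarrow> inj_on c (edges F)"

definition rainbow_free :: "'b graph \<Rightarrow> 'a graph \<Rightarrow> ('a set \<Rightarrow> nat) \<Rightarrow> bool" where
  "rainbow_free H G c \<longleftrightarrow> \<not> (\<exists>F. subgraph F G \<and> rainbow F c \<and> graph_iso F H)"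

text \<open>Finite graphs matter only up to isomorphism, so it suffices to let the complete graphs
  range over those whose vertices are natural numbers.\<close>

definition rainbow_le :: "'a graph \<Rightarrow> 'b graph \<Rightarrow> bool" where
  "rainbow_le H1 H2 \<longleftrightarrow>
     (\<exists>t::nat. t > 0 \<and>
        (\<forall>(G :: nat graph) c.
           complete_graph G \<and> colored_in_at_least G c t \<and> rainbow_free H1 G c
           \<longrightarrow> rainbow_free H2 G c))"

definition path_graph :: "nat \<Rightarrow> nat graph" where
  "path_graph k = ({..<k}, {{i, i + 1} |i. i + 1 < k})"

text \<open>A simple graph, and the cycle on k vertices, only for \<open>k \<ge> 3\<close>.\<close>

definition cycle_graph :: "nat \<Rightarrow> nat graph" where
  "cycle_graph k = ({..<k}, {{i, (i + 1) mod k} |i. i < k})"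

end

(* Make the star at one vertex 0 rainbow, with colors of its own, and use only k - 4 colors on all
   other edges. A rainbow path has at most two edges at 0, hence at most k - 2 edges, so it
   is not P_k; a rainbow path on k - 3 vertices avoiding 0 closes up through 0 to a rainbow C_(k-2). *)
theory Submission
  imports Defs
begin

definition nat_clique :: "nat \<Rightarrow> nat graph" where
  "nat_clique n = ({..<n}, {e. e \<subseteq> {..<n} \<and> card e = 2})"

text \<open>On an edge at 0, \<open>Max e\<close> is the other endpoint, and the offset
  \<open>Suc r\<close> lifts its color above all off-star colors. Off the star, the cap at
  \<open>r\<close> leaves only the colors 1, ..., r, while \<open>Min\<close> makes the path 1, 2,
  ..., r + 1 rainbow.\<close>

definition star_coloring :: "nat \<Rightarrow> nat set \<Rightarrow> nat" where
  "star_coloring r e = (if 0 \<in> e then Suc r + Max e else min (Min e) r)"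

lemma complete_graph_nat_clique: "complete_graph (nat_clique n)"
  by (auto simp: complete_graph_def simple_graph_def nat_clique_def)

lemma star_coloring_star: "star_coloring r {0, i} = Suc r + i"
  by (simp add: star_coloring_def)

lemma star_coloring_off_star:
  "a \<noteq> 0 \<Longrightarrow> b \<noteq> 0 \<Longrightarrow> star_coloring r {a, b} = min (min a b) r"
  by (simp add: star_coloring_def)

text \<open>The star at 0 alone supplies \<open>n\<close> colors, so the number of colors is
  unbounded for fixed \<open>r\<close>.\<close>

lemma colored_in_at_least_star_coloring:
  "colored_in_at_least (nat_clique (Suc n)) (star_coloring r) n"
proof -
  let ?E = "edges (nat_clique (Suc n))"
  have fin: "finite ?E"
    by (rule finite_subset[of _ "Pow {..<Suc n}"]) (auto simp: nat_clique_def)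
  have "(\<lambda>i. Suc r + i) ` {1..n} \<subseteq> star_coloring r ` ?E"
  proof (rule image_subsetI)
    fix i assume "i \<in> {1..n}"
    then have "{0, i} \<in> ?E" by (auto simp: nat_clique_def)
    then show "Suc r + i \<in> star_coloring r ` ?E"
      using star_coloring_star[of r i] by (metis image_eqI)
  qed
  then have "card ((\<lambda>i. Suc r + i) ` {1..n}) \<le> card (star_coloring r ` ?E)"
    using fin by (intro card_mono) auto
  moreover have "card ((\<lambda>i. Suc r + i) ` {1..n}) = n"
    by (subst card_image) (auto simp: inj_on_def)
  ultimately show ?thesis
    by (simp add: colored_in_at_least_def)
qed

text \<open>Inverting the isomorphism lists the vertices along the path, so that its edges can be
  counted by index.\<close>

lemma graph_iso_path_vertices:
  assumes "graph_iso F (path_graph k)"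
  obtains g where "inj_on g {..<k}" and "\<And>i. Suc i < k \<Longrightarrow> {g i, g (Suc i)} \<in> edges F"
proof -
  obtain f where f: "bij_betw f (verts F) {..<k}"
    and fe: "\<forall>u\<in>verts F. \<forall>v\<in>verts F. {u, v} \<in> edges F \<longleftrightarrow> {f u, f v} \<in> edges (path_graph k)"
    using assms by (auto simp: graph_iso_def path_graph_def)
  define g where "g = inv_into (verts F) f"
  have g: "bij_betw g {..<k} (verts F)"
    unfolding g_def by (rule bij_betw_inv_into[OF f])
  show thesis
  proof
    show "inj_on g {..<k}" using g by (rule bij_betw_imp_inj_on)
    fix i assume i: "Suc i < k"
    have "g i \<in> verts F" "g (Suc i) \<in> verts F"
      using i g by (auto dest!: bij_betw_imp_surj_on)
    moreover have "f (g i) = i" "f (g (Suc i)) = Suc i"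
      using i f by (auto simp: g_def bij_betw_inv_into_right)
    moreover have "{i, Suc i} \<in> edges (path_graph k)"
      using i by (auto simp: path_graph_def)
    ultimately show "{g i, g (Suc i)} \<in> edges F" using fe by simp
  qed
qed

text \<open>The path has r + 3 edges: at most two contain 0, and the others must share
  \<open>r\<close> colors.\<close>

lemma rainbow_free_path_star_coloring:
  assumes "r > 0"
  shows "rainbow_free (path_graph (r + 4)) (nat_clique n) (star_coloring r)"
  unfolding rainbow_free_def
proof
  let ?c = "star_coloring r"
  assume "\<exists>F. subgraph F (nat_clique n) \<and> rainbow F ?c \<and> graph_iso F (path_graph (r + 4))"
  then obtain F where rb: "inj_on ?c (edges F)" and iso: "graph_iso F (path_graph (r + 4))"
    by (auto simp: rainbow_def)
  obtain g where g: "inj_on g {..<r + 4}"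
    and ge: "\<And>i. Suc i < r + 4 \<Longrightarrow> {g i, g (Suc i)} \<in> edges F"
    using graph_iso_path_vertices[OF iso] by blast
  let ?e = "\<lambda>i. {g i, g (Suc i)}"
  \<comment> \<open>\<open>I\<close> indexes the edges of the path, \<open>S\<close> those that
    contain the vertex 0.\<close>
  define I where "I = {..<r + 3}"
  define S where "S = {i \<in> I. 0 \<in> ?e i}"
  have g_eq: "g i = g j \<longleftrightarrow> i = j" if "i < r + 4" "j < r + 4" for i j
    using g that by (auto simp: inj_on_def)
  have "inj_on ?e I"
    by (auto simp: inj_on_def I_def doubleton_eq_iff g_eq)
  moreover have "?e ` I \<subseteq> edges F" using ge by (auto simp: I_def)
  ultimately have inj: "inj_on (\<lambda>i. ?c (?e i)) I"
    using comp_inj_on[of ?e I ?c] inj_on_subset[OF rb] by (simp add: comp_def)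
  \<comment> \<open>Both endpoints are positive here, so color 0 does not occur and exactly
    \<open>r\<close> values remain.\<close>
  have "(\<lambda>i. ?c (?e i)) ` (I - S) \<subseteq> {1..r}"
  proof (rule image_subsetI)
    fix i assume i: "i \<in> I - S"
    then have nz: "g i \<noteq> 0" "g (Suc i) \<noteq> 0" by (auto simp: S_def)
    with \<open>r > 0\<close> show "?c (?e i) \<in> {1..r}"
      by (auto simp: star_coloring_off_star)
  qed
  moreover have "inj_on (\<lambda>i. ?c (?e i)) (I - S)"
    using inj by (rule inj_on_subset) auto
  ultimately have "card (I - S) \<le> r"
    using card_inj_on_le[of "\<lambda>i. ?c (?e i)" "I - S" "{1..r}"] by simp
  moreover have "card S \<le> 2"
  proof (cases "\<exists>j<r + 4. g j = 0")
    case True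
    then obtain j where j: "j < r + 4" "g j = 0" by blast
    \<comment> \<open>The edges with index j - 1 and j are the only ones that can contain
      \<open>g j\<close>; for j = 0 truncated subtraction merges the two indices.\<close>
    have "S \<subseteq> {j - 1, j}"
    proof
      fix i assume "i \<in> S"
      then have "i < r + 3" "g i = g j \<or> g (Suc i) = g j"
        using j by (auto simp: S_def I_def)
      then have "i = j \<or> Suc i = j"
        using g_eq[of i j] g_eq[of "Suc i" j] j by auto
      then show "i \<in> {j - 1, j}" by auto
    qed
    then have "card S \<le> card {j - 1, j}" by (intro card_mono) auto
    also have "\<dots> \<le> 2" by (simp add: card_insert_if)
    finally show ?thesis .
  next
    case False
    have "S = {}"
    proof (rule equals0I)
      fix i assume "i \<in> S"
      then have "i < r + 3" "g i = 0 \<or> g (Suc i) = 0"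
        by (auto simp: S_def I_def)
      then show False using False[simplified] 
        by (auto dest: spec[of _ i] spec[of _ "Suc i"])
    qed
    then show ?thesis by simp
  qed
  moreover have "card (I - S) + card S = r + 3"
  proof -
    have "S \<subseteq> I" "finite I" by (auto simp: S_def I_def)
    then show ?thesis
      using card_Diff_subset[of S I] card_mono[of I S] finite_subset[of S I]
      by (simp add: I_def)
  qed
  ultimately show False by simp
qed

text \<open>Only the index \<open>n\<close> wraps around; separating its edge removes
  \<open>mod\<close>.\<close>

lemma edges_cycle_graph:
  "edges (cycle_graph (Suc n)) = insert {0, n} ((\<lambda>i. {i, Suc i}) ` {..<n})"
proof -
  have "edges (cycle_graph (Suc n)) = (\<lambda>i. {i, (i + 1) mod Suc n}) ` insert n {..<n}"
    by (auto simp: cycle_graph_def less_Suc_eq)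
  also have "\<dots> = insert {0, n} ((\<lambda>i. {i, Suc i}) ` {..<n})"
    by (auto simp: insert_commute)
  finally show ?thesis .
qed

lemma simple_cycle_graph:
  assumes "n \<ge> 2"
  shows "simple_graph (cycle_graph (Suc n))"
  unfolding simple_graph_def edges_cycle_graph
  using assms by (auto simp: cycle_graph_def)

text \<open>Along 0, 1, ..., r + 1 the edge from i to i + 1 has color i for i = 1, ..., r, and the
  edges from 0 to 1 and to r + 1 have colors r + 2 and 2r + 2.\<close>

lemma rainbow_cycle_star_coloring:
  "rainbow (cycle_graph (r + 2)) (star_coloring r)"
proof -
  \<comment> \<open>Index 0 is split off because its edge belongs to the star.\<close>
  have split: "{..<Suc r} = insert 0 (Suc ` {..<r})"
    by (auto simp: image_iff less_Suc_eq_0_disj)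
  have E: "edges (cycle_graph (r + 2)) =
    insert {0, Suc r} (insert {0, 1} ((\<lambda>i. {Suc i, Suc (Suc i)}) ` {..<r}))"
    using edges_cycle_graph[of "Suc r"] by (simp add: split image_image)
  \<comment> \<open>Since Suc i \<le> r, the cap at \<open>r\<close> has no effect on these
    edges.\<close>
  have c: "star_coloring r {Suc i, Suc (Suc i)} = Suc i" if "i < r" for i
    using that by (simp add: star_coloring_off_star)
  show ?thesis
    unfolding rainbow_def E
    using star_coloring_star[of r "Suc r"] star_coloring_star[of r 1]
    by (auto simp: inj_on_def c)
qed

lemma not_rainbow_free_cycle_star_coloring:
  assumes "r > 0" and "r + 2 \<le> n"
  shows "\<not> rainbow_free (cycle_graph (r + 2)) (nat_clique n) (star_coloring r)"
proof -
  let ?C = "cycle_graph (r + 2)"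
  have "simple_graph ?C"
    using simple_cycle_graph[of "Suc r"] assms(1) by simp
  moreover have "verts ?C \<subseteq> {..<n}"
    using assms(2) by (auto simp: cycle_graph_def)
  ultimately have "subgraph ?C (nat_clique n)"
    by (auto simp: subgraph_def nat_clique_def simple_graph_def)
  moreover have "graph_iso ?C ?C"
    unfolding graph_iso_def by (rule exI[of _ "\<lambda>x. x"]) (simp add: bij_betw_def)
  ultimately show ?thesis
    using rainbow_cycle_star_coloring unfolding rainbow_free_def by blast
qed

theorem theorem9:
  fixes k :: nat
  assumes "k \<ge> 5"
  shows "\<not> rainbow_le (path_graph k) (cycle_graph (k - 2))"
proof -
  define r where "r = k - 4"
  have r: "r > 0" "k = r + 4" "k - 2 = r + 2" using assms by (auto simp: r_def)
  \<comment> \<open>Every threshold \<open>t\<close> gets its own counterexample: the clique grows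
    with \<open>t\<close>, while \<open>r\<close> depends only on \<open>k\<close>.\<close>
  have "\<exists>G c. complete_graph (G :: nat graph) \<and> colored_in_at_least G c t \<and>
    rainbow_free (path_graph k) G c \<and> \<not> rainbow_free (cycle_graph (k - 2)) G c" for t
  proof (intro exI conjI)
    \<comment> \<open>The star in this clique has t + k edges, enough for \<open>t\<close> colors,
      and there is room for the cycle on the vertices 0, ..., r + 1.\<close>
    let ?G = "nat_clique (Suc (t + k))"
    show "complete_graph ?G" by (rule complete_graph_nat_clique)
    show "colored_in_at_least ?G (star_coloring r) t"
      using colored_in_at_least_star_coloring[of "t + k" r]
      by (simp add: colored_in_at_least_def)
    show "rainbow_free (path_graph k) ?G (star_coloring r)"
      unfolding r(2) using r(1) by (rule rainbow_free_path_star_coloring)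
    show "\<not> rainbow_free (cycle_graph (k - 2)) ?G (star_coloring r)"
      unfolding r(3) by (rule not_rainbow_free_cycle_star_coloring) (use r in auto)
  qed
  then show ?thesis unfolding rainbow_le_def by blast
qed

end
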